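(* For all complex $a\neq 0$ and $x\notin\{0,-1,-2,\dots\}$ for which the series on the left converges, $$\sum _{k=0}^{\infty } \frac{a^k E_k(x)}{(k+1)!}=\frac{2 e^{a x} \, {}_2F_1\left(1,x;1+x;-e^a\right)+x \left(\psi ^{(0)}\left(\frac{x}{2}\right)-\psi ^{(0)}\left(\frac{1+x}{2}\right)\right)}{a x}.$$
   Context: $E_k(x)$ is the $k$-th Euler polynomial, $\frac{2e^{xt}}{e^t+1}=\sum_{k\ge0}E_k(x)\frac{t^k}{k!}$ for $|t|<\pi$; ${}_2F_1$ is the Gauss hypergeometric function (principal branch, cut along $[1,\infty)$); $\psi^{(0)}=\Gamma'/\Gamma$ is the digamma function. *)

theory Defs
  imports "HOL-Complex_Analysis.Complex_Analysis"
begin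

text \<open>
  The Euler polynomials are read off from the formal power series of their exponential generating
  function. The lemma \<open>euler_poly_sums\<close> gives the analytic form of this, with the sum converging
  to the generating function for \<open>\<bar>t\<bar> < \<pi>\<close>.
\<close>

definition euler_poly :: "nat \<Rightarrow> complex \<Rightarrow> complex" where
  "euler_poly k x = fact k * fps_nth (fps_const 2 * fps_exp x / (fps_exp 1 + 1)) k"

lemma exp_plus_1_nonzero:
  fixes t :: complex
  assumes "norm t < pi"
  shows "exp t + 1 \<noteq> 0"
proof
  assume "exp t + 1 = 0"
  hence e: "exp t = exp (\<i> * pi)"
    by (simp add: eq_neg_iff_add_eq_0)
  then obtain n :: int where n: "t = \<i> * pi + of_int (2 * n) * pi * \<i>"
    using e unfolding exp_eq by (auto simp: mult_ac)
  have "Im t = of_int (2 * n + 1) * pi"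
    by (simp add: n algebra_simps)
  moreover have "\<bar>real_of_int (2 * n + 1)\<bar> \<ge> 1"
  proof -
    have "1 \<le> \<bar>2 * n + 1\<bar>"
      by presburger
    hence "real_of_int 1 \<le> real_of_int \<bar>2 * n + 1\<bar>"
      by (simp only: of_int_le_iff)
    thus ?thesis
      by (simp only: of_int_abs of_int_1)
  qed
  ultimately have "\<bar>Im t\<bar> \<ge> pi"
    using mult_right_mono[of 1 "\<bar>real_of_int (2 * n + 1)\<bar>" pi] by (simp add: abs_mult)
  with abs_Im_le_cmod[of t] assms show False
    by linarith
qed

lemma euler_poly_sums:
  fixes t x :: complex
  assumes "norm t < pi"
  shows "(\<lambda>k. euler_poly k x * t ^ k / fact k) sums (2 * exp (x * t) / (exp t + 1))"
proof -
  have "(\<lambda>t::complex. 2 * exp (x * t) / (exp (1 * t) + 1)) has_fps_expansion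
          (fps_const 2 * fps_exp x / (fps_exp 1 + 1))"
    by (intro fps_expansion_intros) auto
  moreover have "(\<lambda>t::complex. 2 * exp (x * t) / (exp (1 * t) + 1)) holomorphic_on eball 0 (ereal pi)"
    using exp_plus_1_nonzero by (intro holomorphic_intros) (auto simp: in_eball_iff)
  ultimately have "(\<lambda>k. fps_nth (fps_const 2 * fps_exp x / (fps_exp 1 + 1)) k * t ^ k) sums
                     (2 * exp (x * t) / (exp (1 * t) + 1))"
    by (rule has_fps_expansion_imp_sums_complex) (use assms in auto)
  thus ?thesis
    by (simp add: euler_poly_def)
qed

text \<open>
  The principal branch of the Gauss hypergeometric function is the holomorphic continuation of the
  Gauss series from the unit disc to the plane cut along \<open>[1, \<infinity>)\<close>. By \<open>hyp2F1_unique\<close> it does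
  not depend on the choice made by \<open>SOME\<close> off the cut; its values on the cut are left unspecified.
  As usual, \<open>c\<close> is meant not to be a non-positive integer.
\<close>

definition slit_plane :: "complex set" where
  "slit_plane = - (complex_of_real ` {1..})"

definition is_hyp2F1 :: "complex \<Rightarrow> complex \<Rightarrow> complex \<Rightarrow> (complex \<Rightarrow> complex) \<Rightarrow> bool" where
  "is_hyp2F1 a b c F \<longleftrightarrow> F holomorphic_on slit_plane \<and>
     (\<forall>z. norm z < 1 \<longrightarrow>
        (\<lambda>n. pochhammer a n * pochhammer b n / (pochhammer c n * fact n) * z ^ n) sums F z)"

definition hyp2F1 :: "complex \<Rightarrow> complex \<Rightarrow> complex \<Rightarrow> complex \<Rightarrow> complex" where
  "hyp2F1 a b c = (SOME F. is_hyp2F1 a b c F)"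

lemma hyp2F1_unique:
  assumes F: "is_hyp2F1 a b c F" and z: "z \<in> slit_plane"
  shows "hyp2F1 a b c z = F z"
proof -
  have G: "is_hyp2F1 a b c (hyp2F1 a b c)"
    unfolding hyp2F1_def by (rule someI[of _ F]) (rule F)
  show ?thesis
  proof (rule analytic_continuation_open[of "ball 0 1" slit_plane "hyp2F1 a b c" F])
    show "open slit_plane"
      unfolding slit_plane_def by (intro open_Compl closed_slot_right)
    show "connected slit_plane"
      unfolding slit_plane_def
      using starlike_imp_connected[OF starlike_slotted_complex_plane_right[of 1]] by simp
    show "ball 0 1 \<subseteq> slit_plane"
      by (auto simp: slit_plane_def)
    show "hyp2F1 a b c w = F w" if "w \<in> ball 0 1" for w
      using that F G by (auto simp: is_hyp2F1_def intro: sums_unique2)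
  qed (use F G z in \<open>auto simp: is_hyp2F1_def\<close>)
qed

end

theory Submission
  imports Defs "HOL-Probability.Characteristic_Functions" "HOL-Real_Asymp.Real_Asymp"
begin

text \<open>
  Integrating the generating function \<open>2 * exp (x * t) / (exp t + 1)\<close> of the Euler polynomials from 0
  to \<open>a\<close> and dividing by \<open>a\<close> gives the series on the left. A primitive is
  \<open>H t = 2 * exp (t * x) * F (- exp t) / x\<close> where \<open>F = hyp2F1 1 x (1 + x)\<close> continues
  the series \<open>\<Sum>n. x / (x + n) * z ^ n\<close>, because \<open>F\<close> satisfies \<open>z * F' z + x * F z = x / (1 - z)\<close>
  (\<open>hyp2F1_ode\<close>, \<open>euler_prim_deriv\<close>). So the sum is
  \<open>(H a - H 0) / a\<close>, and \<open>H 0 = 2 * F (-1) / x\<close> is an alternating series that evaluates to a difference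
  of digamma values (\<open>hyp2F1_at_minus_1\<close>).

  Three points need work. First, \<open>hyp2F1\<close> has its meaning only if the Gauss series continues to the
  slit plane. The continuation comes from the integral of \<open>u powr (s - 1) / (1 - z * u)\<close> over \<open>{0..1}\<close>,
  where \<open>s = x + N\<close> has large real part (\<open>lerch_series_continuation\<close>).

  Second, the identification of \<open>H\<close> as a primitive is valid on the strip \<open>\<bar>Im t\<bar> < \<pi>\<close>, where \<open>- exp t\<close> avoids the cut. Summability
  puts \<open>a\<close> into this strip: the generating function has simple poles at \<open>\<plusminus>\<i> * \<pi>\<close>, the integrated
  series diverges there by Abel's theorem and l'Hopital's rule (\<open>not_summable_at_poles\<close>), and
  hence also outside the closed disc of radius \<open>\<pi>\<close>.

  Third, the series may converge at points of the circle of radius \<open>\<pi>\<close>. There, as for \<open>F (-1)\<close>,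
  Abel's theorem carries the identity from the open disc to the boundary
  (\<open>euler_poly_integrated_abel\<close>).
\<close>

section \<open>Abel's limit theorem\<close>

text \<open>
  With \<open>t n\<close> the difference between the partial sums and their limit \<open>s\<close>, summation by
  parts turns the deviation of the power series from \<open>s\<close> into \<open>(1 - r) * (\<Sum>n. t n * r ^ n)\<close>. The factor
  \<open>1 - r\<close> compensates the total weight of the geometric series, and \<open>t\<close> tends to 0.
\<close>
lemma abel_limit:
  fixes c :: "nat \<Rightarrow> 'a :: {real_normed_field, banach}"
  assumes "c sums s"
  shows "((\<lambda>r. \<Sum>n. c n * of_real r ^ n) \<longlongrightarrow> s) (at_left (1::real))"
proof -
  define t where "t n = (\<Sum>k\<le>n. c k) - s" for n
  have t: "t \<longlonglongrightarrow> 0"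
    using assms unfolding t_def sums_def_le by (simp add: LIM_zero)
  (* Summation by parts, written as the Cauchy product with the geometric series: the partial
     sums of c are the coefficients of the product. *)
  have by_parts: "(\<lambda>n. t n * of_real r ^ n) sums
                    (((\<Sum>n. c n * of_real r ^ n) - s) / of_real (1 - r))"
    and abs_conv: "summable (\<lambda>n. norm (t n) * r ^ n)"
    if r: "0 < r" "r < 1" for r :: real
  proof -
    have geom: "(\<lambda>n. (of_real r :: 'a) ^ n) sums (1 / (1 - of_real r))"
      by (rule geometric_sums) (use r in auto)
    have "summable (\<lambda>n. norm (c n * of_real r ^ n))"
      by (rule powser_insidea[of c 1]) (use assms r in \<open>auto simp: sums_iff\<close>)
    moreover have "summable (\<lambda>n. norm ((of_real r :: 'a) ^ n))"
      using r by (auto simp: norm_power)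
    ultimately have "(\<lambda>n. \<Sum>k\<le>n. (c k * of_real r ^ k) * of_real r ^ (n - k)) sums
                       ((\<Sum>n. c n * of_real r ^ n) * (\<Sum>n. of_real r ^ n))"
      by (rule Cauchy_product_sums)
    also have "(\<Sum>n. (of_real r :: 'a) ^ n) = 1 / (1 - of_real r)"
      using geom by (simp add: sums_iff)
    also have "(\<lambda>n. \<Sum>k\<le>n. (c k * of_real r ^ k) * of_real r ^ (n - k)) =
               (\<lambda>n. (\<Sum>k\<le>n. c k) * of_real r ^ n)"
      by (auto simp: fun_eq_iff sum_distrib_right mult.assoc simp flip: power_add intro!: sum.cong)
    finally show "(\<lambda>n. t n * of_real r ^ n) sums
                    (((\<Sum>n. c n * of_real r ^ n) - s) / of_real (1 - r))"
      using sums_diff[OF _ sums_mult[OF geom, of s]]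
      by (fastforce simp: t_def algebra_simps diff_divide_distrib)
    have "t \<longlonglongrightarrow> 0" by fact
    hence "Bseq t" by (rule convergentI[THEN convergent_imp_Bseq])
    then obtain B where B: "\<And>n. norm (t n) \<le> B" unfolding Bseq_def by auto
    show "summable (\<lambda>n. norm (t n) * r ^ n)"
    proof (rule summable_comparison_test')
      show "summable (\<lambda>n. B * r ^ n)" using r by (intro summable_mult summable_geometric) auto
      show "norm (norm (t n) * r ^ n) \<le> B * r ^ n" for n
        using B[of n] r by (auto simp: abs_mult intro!: mult_right_mono)
    qed
  qed
  show ?thesis
  proof (rule tendstoI)
    fix e :: real assume e: "e > 0"
    have "\<forall>\<^sub>F n in sequentially. norm (t n) < e / 2"
      using t e by (auto dest!: tendstoD[of _ _ _ "e / 2"] simp: dist_norm)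
    then obtain N where N: "\<And>n. n \<ge> N \<Longrightarrow> norm (t n) < e / 2"
      by (auto simp: eventually_at_top_linorder)
    define M where "M = (\<Sum>n<N. norm (t n))"
    (* The finitely many large t n contribute at most (1 - r) * M, the others at most the
       geometric series with coefficient e / 2. *)
    have bound: "norm ((\<Sum>n. c n * of_real r ^ n) - s) \<le> (1 - r) * M + e / 2"
      if r: "0 < r" "r < 1" for r :: real
    proof -
      have "(\<lambda>n. if n < N then norm (t n) else 0) sums M"
        using sums_If_finite_set[of "{..<N}" "\<lambda>n. norm (t n)"] by (simp add: M_def)
      moreover have "(\<lambda>n. e / 2 * r ^ n) sums (e / 2 * (1 / (1 - r)))"
        using r by (intro sums_mult geometric_sums) auto
      ultimately have maj: "(\<lambda>n. (if n < N then norm (t n) else 0) + e / 2 * r ^ n) sums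
                        (M + e / 2 * (1 / (1 - r)))"
        by (rule sums_add)
      have le: "norm (t n) * r ^ n \<le> (if n < N then norm (t n) else 0) + e / 2 * r ^ n" for n
      proof (cases "n < N")
        case True
        have "norm (t n) * r ^ n \<le> norm (t n) * 1"
          using r by (intro mult_left_mono power_le_one) auto
        also have "\<dots> \<le> norm (t n) + e / 2 * r ^ n"
          using r e by simp
        finally show ?thesis using True by simp
      next
        case False
        thus ?thesis using N[of n] r by (auto intro!: mult_right_mono)
      qed
      have "norm (((\<Sum>n. c n * of_real r ^ n) - s) / of_real (1 - r)) = norm (\<Sum>n. t n * of_real r ^ n)"
        using by_parts[OF r] by (simp add: sums_iff)
      also have "\<dots> \<le> (\<Sum>n. norm (t n) * r ^ n)"
        using abs_conv[OF r] r summable_norm[of "\<lambda>n. t n * of_real r ^ n"]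
        by (simp add: norm_mult norm_power)
      also have "\<dots> \<le> M + e / 2 * (1 / (1 - r))"
        using suminf_le[OF le abs_conv[OF r] sums_summable[OF maj]] maj by (simp add: sums_iff)
      finally have "norm ((\<Sum>n. c n * of_real r ^ n) - s) / (1 - r) \<le> M + e / 2 * (1 / (1 - r))"
        using r by (simp add: norm_divide del: of_real_diff)
      moreover have cancel: "(M + e / 2 * (1 / q)) * q = q * M + e / 2" if "q \<noteq> 0" for q
        using that by (simp add: field_simps)
      ultimately have "norm ((\<Sum>n. c n * of_real r ^ n) - s) \<le> (M + e / 2 * (1 / (1 - r))) * (1 - r)"
        using r by (simp add: pos_divide_le_eq)
      also have "\<dots> = (1 - r) * M + e / 2"
        using r by (intro cancel) auto
      finally show ?thesis .
    qed
    have "((\<lambda>r. (1 - r) * M) \<longlongrightarrow> (1 - 1) * M) (at_left 1)"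
      by (intro tendsto_intros)
    hence "\<forall>\<^sub>F r in at_left 1. (1 - r) * M < e / 2"
      by (rule order_tendstoD) (use e in auto)
    moreover have "\<forall>\<^sub>F r in at_left (1::real). r \<in> {0<..<1}"
      by (rule eventually_at_leftI[of 0]) auto
    ultimately show "\<forall>\<^sub>F r in at_left 1. dist (\<Sum>n. c n * of_real r ^ n) s < e"
    proof eventually_elim
      case (elim r)
      thus ?case using bound[of r] by (auto simp: dist_norm)
    qed
  qed
qed

section \<open>The hypergeometric function on the slit plane\<close>

lemma add_of_nat_neq_0:
  assumes "x \<notin> \<int>\<^sub>\<le>\<^sub>0"
  shows "x + of_nat n \<noteq> (0 :: complex)"
  using assms by (metis add_eq_0_iff2 minus_of_nat_in_nonpos_Ints)

lemma open_slit_plane: "open slit_plane"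
  unfolding slit_plane_def by (intro open_Compl closed_slot_right)

lemma one_minus_mult_nonzero:
  assumes "z \<in> slit_plane" "0 \<le> u" "u \<le> 1"
  shows   "1 - z * of_real u \<noteq> 0"
proof
  assume eq: "1 - z * of_real u = 0"
  hence "u \<noteq> 0" by auto
  with eq assms have "z = of_real (1 / u)" "1 / u \<in> {1..}"
    by (auto simp: field_simps)
  with assms(1) show False unfolding slit_plane_def by blast
qed

text \<open>
  For \<open>Re s > 1\<close> the integrand is continuous up to \<open>u = 0\<close>, and its pole \<open>u = 1 / z\<close> lies in \<open>{0..1}\<close> only
  for \<open>z\<close> on the cut. Differentiation under the integral sign is therefore possible on every disc
  inside the slit plane; discs are used because the Leibniz rule wants a convex parameter domain.
\<close>
lemma euler_integral_holomorphic:
  assumes "Re s > 1"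
  shows "(\<lambda>z. integral {0..1} (\<lambda>u. of_real u powr (s - 1) / (1 - z * of_real u))) holomorphic_on slit_plane"
proof -
  have nz: "complex_of_real u * z \<noteq> 1" "z * complex_of_real u \<noteq> 1"  if "z \<in> slit_plane" "0 \<le> u" "u \<le> 1" for z u
    using one_minus_mult_nonzero[OF that] by (auto simp: mult.commute)
  have "(\<lambda>z. integral (cbox 0 1) (\<lambda>u. of_real u powr (s - 1) / (1 - z * of_real u))) holomorphic_on ball z0 e"
    if sub: "ball z0 e \<subseteq> slit_plane" for z0 e
  proof (rule leibniz_rule_holomorphic)
    fix z :: complex and u :: real
    assume "z \<in> ball z0 e" "u \<in> cbox 0 1"
    with sub have z: "z \<in> slit_plane" "0 \<le> u" "u \<le> 1" by auto
    show "((\<lambda>z. of_real u powr (s - 1) / (1 - z * of_real u)) has_field_derivative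
            of_real u powr (s - 1) * of_real u / (1 - z * of_real u)\<^sup>2) (at z within ball z0 e)"
      using nz[OF z] by (auto intro!: derivative_eq_intros simp: power2_eq_square)
  next
    fix z assume "z \<in> ball z0 e"
    with sub have z: "z \<in> slit_plane" by auto
    show "(\<lambda>u. of_real u powr (s - 1) / (1 - z * of_real u)) integrable_on cbox 0 1"
      using assms nz[OF z] by (intro integrable_continuous continuous_intros) auto
  next
    show "continuous_on (ball z0 e \<times> cbox 0 1)
            (\<lambda>(z, u). of_real u powr (s - 1) * of_real u / (1 - z * of_real u)\<^sup>2)"
      unfolding case_prod_unfold using assms sub nz
      by (intro continuous_intros) fastforce+
  qed auto
  thus ?thesis
    using open_slit_plane
    by (intro analytic_imp_holomorphic) (auto simp: analytic_on_def elim!: openE)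
qed

text \<open>
  Expand the kernel as a geometric series. Convergence is uniform in \<open>u\<close>, with majorant
  \<open>norm z ^ n\<close>, so that integration is termwise.
\<close>
lemma euler_integral_sums:
  assumes "Re s > 1" "norm z < 1"
  shows "(\<lambda>n. z ^ n / (s + of_nat n)) sums
           integral {0..1} (\<lambda>u. of_real u powr (s - 1) / (1 - z * of_real u))"
proof -
  let ?f = "\<lambda>n u. z ^ n * of_real u powr (s + of_nat n - 1)"
  have int: "(?f n has_integral z ^ n / (s + of_nat n)) {0..1}" for n
  proof -
    let ?s = "s + of_nat n"
    have s: "Re ?s > 0" "?s \<noteq> 0" using assms by (auto simp: complex_eq_iff)
    have "((\<lambda>t. complex_of_real t powr (?s - 1)) has_integral
            (of_real 1 powr ?s / ?s - of_real 0 powr ?s / ?s)) {0..1}" using s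
      by (intro fundamental_theorem_of_calculus_interior)
         (auto intro!: continuous_intros derivative_eq_intros has_vector_derivative_real_field)
    from has_integral_mult_right[OF this, of "z ^ n"] show ?thesis
      by simp
  qed
  have split: "complex_of_real u powr (s + of_nat n - 1) = of_real u powr (s - 1) * of_real u ^ n"
    if "u \<ge> 0" for u n
  proof (cases "u = 0")
    case False
    have "s + of_nat n - 1 = (s - 1) + of_nat n" by simp
    thus ?thesis using that False powr_add[of "complex_of_real u" "s - 1" "of_nat n"]
      by (simp only:) (simp add: powr_nat')
  qed auto
  have sums: "(\<lambda>n. ?f n u) sums (of_real u powr (s - 1) / (1 - z * of_real u))"
    if u: "0 \<le> u" "u \<le> 1" for u
  proof -
    have "norm (z * of_real u) < 1"
      using assms u mult_right_le_one_le[of "norm z" u] by (auto simp: norm_mult)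
    from sums_mult[OF geometric_sums[OF this], of "of_real u powr (s - 1)"] show ?thesis
      using u by (simp add: split power_mult_distrib mult_ac)
  qed
  have "uniform_limit {0..1} (\<lambda>n u. \<Sum>k<n. ?f k u) (\<lambda>u. \<Sum>k. ?f k u) sequentially"
  proof (rule Weierstrass_m_test)
    show "summable (\<lambda>n. norm z ^ n)" using assms by (intro summable_geometric) auto
    fix n and u :: real assume u: "u \<in> {0..1}"
    have "norm (complex_of_real u powr (s + of_nat n - 1)) \<le> 1"
      using u assms by (auto simp: norm_powr_real_powr intro!: powr_le1)
    thus "norm (?f n u) \<le> norm z ^ n"
      by (simp add: norm_mult norm_power mult_left_le)
  qed
  also have "?this \<longleftrightarrow> uniform_limit {0..1} (\<lambda>n u. \<Sum>k<n. ?f k u)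
               (\<lambda>u. of_real u powr (s - 1) / (1 - z * of_real u)) sequentially"
    using sums by (intro uniform_limit_cong') (auto simp: sums_iff)
  finally obtain I J where IJ:
     "\<And>n. ((\<lambda>u. \<Sum>k<n. ?f k u) has_integral I n) {0..1}"
     "((\<lambda>u. of_real u powr (s - 1) / (1 - z * of_real u)) has_integral J) {0..1}"
     "I \<longlonglongrightarrow> J"
    by (rule uniform_limit_integral) (use assms in \<open>auto intro!: continuous_intros\<close>)
  have "I = (\<lambda>n. \<Sum>k<n. z ^ k / (s + of_nat k))"
    using has_integral_unique[OF IJ(1) has_integral_sum[OF _ int]] by auto
  thus ?thesis using IJ(2,3) by (simp add: sums_def integral_unique)
qed

text \<open>
  The integral is available only when \<open>Re x\<close> is large. For the other \<open>x\<close>, split off the first \<open>N\<close>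
  terms of the series: the remainder is \<open>z ^ N\<close> times the series for \<open>x + N\<close>.
\<close>

lemma lerch_series_continuation:
  assumes "x \<notin> \<int>\<^sub>\<le>\<^sub>0"
  obtains G where "G holomorphic_on slit_plane"
    and "\<And>z. norm z < 1 \<Longrightarrow> (\<lambda>n. z ^ n / (x + of_nat n)) sums G z"
proof -
  obtain N :: nat where "1 - Re x < real N"
    using reals_Archimedean2 by blast
  hence N: "Re (x + of_nat N) > 1" by simp
  define I where "I z = integral {0..1} (\<lambda>u. of_real u powr (x + of_nat N - 1) / (1 - z * of_real u))"
    for z :: complex
  define G where "G z = (\<Sum>n<N. z ^ n / (x + of_nat n)) + z ^ N * I z" for z
  note add_of_nat_neq_0[OF assms]
  hence "G holomorphic_on slit_plane"
    unfolding G_def I_def by (intro holomorphic_intros euler_integral_holomorphic N)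
  moreover have "(\<lambda>n. z ^ n / (x + of_nat n)) sums G z" if "norm z < 1" for z
    using sums_mult[OF euler_integral_sums[OF N that], of "z ^ N"]
          sums_iff_shift[of "\<lambda>n. z ^ n / (x + of_nat n)" N "z ^ N * I z"]
    by (simp add: I_def G_def power_add algebra_simps)
  ultimately show thesis by (rule that)
qed

lemma pochhammer_ratio:
  assumes "x \<notin> \<int>\<^sub>\<le>\<^sub>0"
  shows "pochhammer 1 n * pochhammer x n / (pochhammer (1 + x) n * fact n) = x / (x + of_nat n :: complex)"
proof -
  have "x + of_nat n \<noteq> 0"
    using assms by (rule add_of_nat_neq_0)
  moreover have "x * pochhammer (1 + x) n = (x + of_nat n) * pochhammer x n"
    using pochhammer_rec[of x n] pochhammer_rec'[of x n] by (simp add: add.commute)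
  moreover have "pochhammer (1 + x) n \<noteq> 0"
  proof
    assume "pochhammer (1 + x) n = 0"
    then obtain k where "1 + x = - of_nat k"
      by (auto simp: pochhammer_eq_0_iff)
    hence "x + of_nat (Suc k) = 0"
      by (simp add: eq_neg_iff_add_eq_0 add_ac)
    with add_of_nat_neq_0[OF assms, of "Suc k"] show False by contradiction
  qed
  ultimately show ?thesis
    by (simp add: pochhammer_fact[symmetric] field_simps)
qed

text \<open>
  \<open>hyp2F1\<close> is chosen by \<open>SOME\<close>; the continuation just constructed shows that there is something to
  choose, so that the chosen function has the defining properties.
\<close>
lemma hyp2F1_properties:
  assumes "x \<notin> \<int>\<^sub>\<le>\<^sub>0"
  shows hyp2F1_holomorphic: "hyp2F1 1 x (1 + x) holomorphic_on slit_plane"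
    and hyp2F1_sums: "\<And>z. norm z < 1 \<Longrightarrow> (\<lambda>n. x / (x + of_nat n) * z ^ n) sums hyp2F1 1 x (1 + x) z"
proof -
  obtain G where G: "G holomorphic_on slit_plane"
     "\<And>z. norm z < 1 \<Longrightarrow> (\<lambda>n. z ^ n / (x + of_nat n)) sums G z"
    using lerch_series_continuation[OF assms] by blast
  have "is_hyp2F1 1 x (1 + x) (\<lambda>z. x * G z)"
    unfolding is_hyp2F1_def pochhammer_ratio[OF assms]
    using G(1) sums_mult[OF G(2), of _ x] by (auto intro!: holomorphic_intros)
  hence "is_hyp2F1 1 x (1 + x) (hyp2F1 1 x (1 + x))"
    unfolding hyp2F1_def by (rule someI[of _ "\<lambda>z. x * G z"])
  thus "hyp2F1 1 x (1 + x) holomorphic_on slit_plane"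
    and "\<And>z. norm z < 1 \<Longrightarrow> (\<lambda>n. x / (x + of_nat n) * z ^ n) sums hyp2F1 1 x (1 + x) z"
    unfolding is_hyp2F1_def pochhammer_ratio[OF assms] by auto
qed

text \<open>
  Inside the disc, \<open>z * d/dz + x\<close> multiplies the \<open>n\<close>-th term by \<open>n + x\<close>, which cancels the denominator and
  leaves a geometric series. Both sides are holomorphic on the connected slit plane.
\<close>
lemma hyp2F1_ode:
  assumes x: "x \<notin> \<int>\<^sub>\<le>\<^sub>0" and z: "z \<in> slit_plane"
  shows "z * deriv (hyp2F1 1 x (1 + x)) z + x * hyp2F1 1 x (1 + x) z = x / (1 - z)"
proof -
  let ?F = "hyp2F1 1 x (1 + x)"
  have nz: "1 - w \<noteq> 0" if "w \<in> slit_plane" for w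
    using one_minus_mult_nonzero[OF that, of 1] by simp
  show ?thesis
  proof (rule analytic_continuation_open[of "ball 0 1" slit_plane
           "\<lambda>z. z * deriv ?F z + x * ?F z" "\<lambda>z. x / (1 - z)"])
    show "connected slit_plane"
      unfolding slit_plane_def
      using starlike_imp_connected[OF starlike_slotted_complex_plane_right[of 1]] by simp
    show "ball 0 1 \<subseteq> slit_plane"
      by (auto simp: slit_plane_def)
    show "w * deriv ?F w + x * ?F w = x / (1 - w)" if "w \<in> ball 0 1" for w
    proof -
      define c where "c n = x / (x + of_nat n)" for n :: nat
      have w: "norm w < 1" using that by simp
      have "w \<in> slit_plane" using w by (auto simp: slit_plane_def)
      hence D: "(?F has_field_derivative deriv ?F w) (at w)"
        using hyp2F1_holomorphic[OF x] open_slit_plane holomorphic_derivI by blast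
      have "(\<lambda>n. diffs c n * w ^ n) sums deriv ?F w"
        by (rule termdiffs_sums_strong[OF _ D w]) (use hyp2F1_sums[OF x] in \<open>auto simp: c_def\<close>)
      hence "(\<lambda>n. of_nat n * c n * w ^ (n - 1)) sums deriv ?F w"
        using diffs_equiv[of c w] by (simp add: sums_iff)
      from sums_mult[OF this, of w] have "(\<lambda>n. of_nat n * c n * w ^ n) sums (w * deriv ?F w)"
        by (rule sums_cong[THEN iffD1, rotated]) (auto simp: power_eq_if)
      moreover have "(\<lambda>n. c n * w ^ n) sums ?F w"
        using hyp2F1_sums[OF x w] by (simp add: c_def)
      ultimately have "(\<lambda>n. of_nat n * c n * w ^ n + x * (c n * w ^ n)) sums (w * deriv ?F w + x * ?F w)"
        by (intro sums_add sums_mult)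
      also have "(\<lambda>n. of_nat n * c n * w ^ n + x * (c n * w ^ n)) = (\<lambda>n. x * w ^ n)"
      proof
        fix n
        have "x + of_nat n \<noteq> 0"
          using x by (rule add_of_nat_neq_0)
        hence "(x + of_nat n) * c n = x"
          by (simp add: c_def)
        thus "of_nat n * c n * w ^ n + x * (c n * w ^ n) = x * w ^ n"
          by (metis distrib_right add.commute mult.assoc)
      qed
      finally show ?thesis
        using sums_mult[OF geometric_sums[OF w], of x] by (simp add: sums_iff)
    qed
  qed (use z open_slit_plane nz in \<open>auto intro!: holomorphic_intros hyp2F1_holomorphic[OF x]\<close>)
qed

lemma minus_exp_in_slit_plane:
  assumes "\<bar>Im t\<bar> < pi"
  shows "- exp t \<in> slit_plane"
  unfolding slit_plane_def
proof
  assume "- exp t \<in> complex_of_real ` {1..}"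
  then obtain y where y: "y \<ge> 1" "exp t = - complex_of_real y"
    by (auto simp: minus_equation_iff)
  have "Ln (exp t) = t" using assms by (intro Ln_exp) auto
  hence "t = Ln (- complex_of_real y)" using y(2) by simp
  hence "Im t = pi" using y(1) by (simp add: Ln_minus Ln_of_real)
  with assms show False by simp
qed

section \<open>The value at minus one\<close>

text \<open>
  Subtracting the limit formulas for the two digamma values removes the logarithms and pairs the
  terms \<open>2 n\<close> and \<open>2 n + 1\<close> of the alternating series. This controls the partial sums of even
  length, and the others differ from them by a term that tends to 0.
\<close>
lemma digamma_difference:
  fixes x :: complex
  assumes "x \<notin> \<int>\<^sub>\<le>\<^sub>0"
  shows "(\<lambda>n. 2 * ((- 1) ^ n / (x + of_nat n))) sums (Digamma ((1 + x) / 2) - Digamma (x / 2))"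
  unfolding sums_def
proof (rule limseq_even_odd)
  let ?c = "\<lambda>n. 2 * ((- 1) ^ n / (x + of_nat n))"
  have x: "x / 2 \<noteq> 0" "(1 + x) / 2 \<noteq> 0"
    using assms by (auto simp: add_eq_0_iff)
  have "(\<lambda>m. (of_real (ln (real m)) - (\<Sum>n<m. inverse ((1 + x) / 2 + of_nat n))) -
               (of_real (ln (real m)) - (\<Sum>n<m. inverse (x / 2 + of_nat n))))
          \<longlonglongrightarrow> Digamma ((1 + x) / 2) - Digamma (x / 2)"
    by (intro tendsto_diff Digamma_LIMSEQ x)
  also have "(\<lambda>m. (of_real (ln (real m)) - (\<Sum>n<m. inverse ((1 + x) / 2 + of_nat n))) -
               (of_real (ln (real m)) - (\<Sum>n<m. inverse (x / 2 + of_nat n)))) =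
             (\<lambda>m. \<Sum>n<m. ?c (2 * n) + ?c (2 * n + 1))"
  proof
    fix m
    have step: "inverse (x / 2 + of_nat n) - inverse ((1 + x) / 2 + of_nat n) = ?c (2 * n) + ?c (2 * n + 1)"
      for n
    proof -
      have "x / 2 + of_nat n = (x + of_nat (2 * n)) / 2"
           "(1 + x) / 2 + of_nat n = (x + of_nat (2 * n + 1)) / 2"
        by (simp_all add: field_simps)
      thus ?thesis by (simp only: inverse_divide) simp
    qed
    have "(of_real (ln (real m)) - (\<Sum>n<m. inverse ((1 + x) / 2 + of_nat n))) -
               (of_real (ln (real m)) - (\<Sum>n<m. inverse (x / 2 + of_nat n))) =
          (\<Sum>n<m. inverse (x / 2 + of_nat n) - inverse ((1 + x) / 2 + of_nat n))"
      by (simp add: sum_subtractf)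
    also have "\<dots> = (\<Sum>n<m. ?c (2 * n) + ?c (2 * n + 1))"
      by (intro sum.cong refl step)
    finally show "(of_real (ln (real m)) - (\<Sum>n<m. inverse ((1 + x) / 2 + of_nat n))) -
               (of_real (ln (real m)) - (\<Sum>n<m. inverse (x / 2 + of_nat n))) =
              (\<Sum>n<m. ?c (2 * n) + ?c (2 * n + 1))" .
  qed
  also have "\<dots> = (\<lambda>m. \<Sum>n<2*m. ?c n)"
  proof
    show "(\<Sum>n<m. ?c (2 * n) + ?c (2 * n + 1)) = (\<Sum>n<2*m. ?c n)" for m
      by (induction m) auto
  qed
  finally show even: "(\<lambda>m. \<Sum>n<2*m. ?c n) \<longlonglongrightarrow> Digamma ((1 + x) / 2) - Digamma (x / 2)" .
  have "(\<lambda>n. ?c (2 * n)) \<longlonglongrightarrow> 0"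
  proof -
    have "filterlim (\<lambda>n. x + of_nat (2 * n)) at_infinity sequentially"
      by (intro tendsto_add_filterlim_at_infinity[OF tendsto_const]
            filterlim_compose[OF tendsto_of_nat] filterlim_subseq) (auto simp: strict_mono_def)
    from tendsto_mult_right[OF tendsto_divide_0[OF tendsto_const this], of 2 1] show ?thesis by simp
  qed
  from tendsto_add[OF even this]
  show "(\<lambda>m. \<Sum>n<2*m+1. ?c n) \<longlonglongrightarrow> Digamma ((1 + x) / 2) - Digamma (x / 2)"
    by simp
qed

text \<open>
  The point \<open>-1\<close> lies on the boundary of the disc of convergence but inside the slit plane, so that
  Abel's theorem identifies the sum of the Gauss series there with the value of its continuation.
\<close>
lemma hyp2F1_at_minus_1:
  assumes "x \<notin> \<int>\<^sub>\<le>\<^sub>0"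
  shows "2 * hyp2F1 1 x (1 + x) (-1) = x * (Digamma ((1 + x) / 2) - Digamma (x / 2))"
proof -
  let ?F = "hyp2F1 1 x (1 + x)"
  define c where "c n = x * (2 * ((- 1) ^ n / (x + of_nat n)))" for n :: nat
  have "c sums (x * (Digamma ((1 + x) / 2) - Digamma (x / 2)))"
    unfolding c_def by (intro sums_mult digamma_difference assms)
  from abel_limit[OF this]
  have lim1: "((\<lambda>r. \<Sum>n. c n * of_real r ^ n) \<longlongrightarrow> x * (Digamma ((1 + x) / 2) - Digamma (x / 2))) (at_left 1)" .
  have "isCont ?F (-1)"
    using holomorphic_on_imp_continuous_on[OF hyp2F1_holomorphic[OF assms]] open_slit_plane
          minus_exp_in_slit_plane[of 0]
    by (simp add: continuous_on_eq_continuous_at)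
  hence "((\<lambda>r. 2 * ?F (- complex_of_real r)) \<longlongrightarrow> 2 * ?F (- complex_of_real 1)) (at_left 1)"
    by (intro tendsto_intros isCont_tendsto_compose[of _ ?F]) auto
  moreover have "\<forall>\<^sub>F r in at_left 1. 2 * ?F (- complex_of_real r) = (\<Sum>n. c n * of_real r ^ n)"
  proof (rule eventually_at_leftI[of 0])
    fix r :: real assume "r \<in> {0<..<1}"
    hence "norm (- complex_of_real r) < 1" by simp
    from sums_mult[OF hyp2F1_sums[OF assms this], of 2]
    have "(\<lambda>n. c n * of_real r ^ n) sums (2 * ?F (- complex_of_real r))"
      by (rule sums_cong[THEN iffD1, rotated]) (simp_all add: c_def power_minus[of "of_real r"])
    thus "2 * ?F (- complex_of_real r) = (\<Sum>n. c n * of_real r ^ n)"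
      by (simp add: sums_iff)
  qed auto
  ultimately have "((\<lambda>r. \<Sum>n. c n * of_real r ^ n) \<longlongrightarrow> 2 * ?F (-1)) (at_left 1)"
    by (simp add: tendsto_cong)
  thus ?thesis
    using tendsto_unique[OF _ _ lim1] by simp
qed

section \<open>A primitive of the generating function\<close>

text \<open>
  For \<open>Re t < 0\<close> the Gauss series turns this into \<open>\<Sum>n. 2 * (-1) ^ n * exp ((x + n) * t) / (x + n)\<close>, the termwise
  primitive of the expansion of the generating function \<open>2 * exp (x * t) / (exp t + 1)\<close> in powers of
  \<open>exp t\<close>.
\<close>
definition euler_prim :: "complex \<Rightarrow> complex \<Rightarrow> complex" where
  "euler_prim x t = 2 * exp (t * x) * hyp2F1 1 x (1 + x) (- exp t) / x"

text \<open>
  Under \<open>z = - exp t\<close> the operator \<open>z * d/dz\<close> becomes \<open>d/dt\<close>, and the factor \<open>exp (t * x)\<close> contributes the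
  term \<open>x * F\<close>: the left-hand side of the differential equation of \<open>F\<close> appears.
\<close>
lemma euler_prim_deriv:
  assumes x: "x \<notin> \<int>\<^sub>\<le>\<^sub>0" and t: "\<bar>Im t\<bar> < pi"
  shows "(euler_prim x has_field_derivative 2 * exp (x * t) / (exp t + 1)) (at t)"
proof -
  let ?F = "hyp2F1 1 x (1 + x)"
  have x0: "x \<noteq> 0" using x by auto
  have S: "- exp t \<in> slit_plane" using t by (rule minus_exp_in_slit_plane)
  have D: "(?F has_field_derivative deriv ?F (- exp t)) (at (- exp t))"
    using hyp2F1_holomorphic[OF x] open_slit_plane S holomorphic_derivI by blast
  have D2: "((\<lambda>t. ?F (- exp t)) has_field_derivative deriv ?F (- exp t) * (- exp t)) (at t)"
    by (rule DERIV_chain2[of ?F _ "\<lambda>t. - exp t", OF D]) (auto intro!: derivative_eq_intros)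
  have "((\<lambda>t. 2 * exp (t * x) * ?F (- exp t) / x) has_field_derivative
          2 * exp (t * x) * ((- exp t) * deriv ?F (- exp t) + x * ?F (- exp t)) / x) (at t)"
    by (rule derivative_eq_intros D2 refl | use x0 in \<open>simp add: field_simps; fail\<close>)+
  thus ?thesis
    using x0 unfolding hyp2F1_ode[OF x S] euler_prim_def
    by (simp add: mult_ac add.commute)
qed

lemma euler_prim_0:
  assumes "x \<notin> \<int>\<^sub>\<le>\<^sub>0"
  shows "euler_prim x 0 = Digamma ((1 + x) / 2) - Digamma (x / 2)"
  using hyp2F1_at_minus_1[OF assms] assms by (auto simp: euler_prim_def)

text \<open>
  The derivative of \<open>euler_prim x\<close> is the generating function, so its Taylor coefficients at 0 are the
  integrated ones.
\<close>
lemma euler_poly_integrated_sums: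
  assumes x: "x \<notin> \<int>\<^sub>\<le>\<^sub>0" and t: "norm t < pi"
  shows "(\<lambda>k. t ^ (k + 1) * euler_poly k x / fact (k + 1)) sums (euler_prim x t - euler_prim x 0)"
proof -
  define A where "A = fps_expansion (euler_prim x) 0"
  have strip: "\<bar>Im w\<bar> < pi" if "norm w < pi" for w
    using that abs_Im_le_cmod[of w] by linarith
  have "euler_prim x field_differentiable at w" if "norm w < pi" for w
    using euler_prim_deriv[OF x strip[OF that]] unfolding field_differentiable_def by blast
  hence hol: "euler_prim x holomorphic_on eball 0 (ereal pi)"
    by (auto simp: holomorphic_on_def in_eball_iff intro: field_differentiable_at_within)
  have A: "euler_prim x has_fps_expansion A"
    unfolding A_def by (rule has_fps_expansion_fps_expansion[of "eball 0 (ereal pi)"]) (use hol in auto)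
  have "(\<lambda>t. 2 * exp (x * t) / (exp (1 * t) + 1)) has_fps_expansion
          (fps_const 2 * fps_exp x / (fps_exp 1 + 1))"
    by (intro fps_expansion_intros) auto
  moreover have "\<forall>\<^sub>F t in nhds 0. deriv (euler_prim x) t = 2 * exp (x * t) / (exp (1 * t) + 1)"
    using eventually_nhds_in_open[of "ball 0 pi" "0::complex"]
    by (auto elim!: eventually_mono intro!: DERIV_imp_deriv euler_prim_deriv x strip)
  ultimately have "deriv (euler_prim x) has_fps_expansion (fps_const 2 * fps_exp x / (fps_exp 1 + 1))"
    using has_fps_expansion_cong[of "deriv (euler_prim x)" "\<lambda>t. 2 * exp (x * t) / (exp (1 * t) + 1)"]
    by blast
  hence dA: "fps_deriv A = fps_const 2 * fps_exp x / (fps_exp 1 + 1)"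
    using has_fps_expansion_deriv[OF A] fps_expansion_unique_complex by blast
  have "euler_poly k x = fact (k + 1) * fps_nth A (k + 1)" for k
    unfolding euler_poly_def dA[symmetric] by (simp add: algebra_simps)
  hence coeff: "fps_nth A (k + 1) = euler_poly k x / fact (k + 1)" for k
    by (metis fact_nonzero nonzero_mult_div_cancel_left)
  have "fps_nth A 0 = euler_prim x 0"
    using A by (simp add: has_fps_expansion_imp_0_eq_fps_nth_0)
  moreover have "(\<lambda>k. fps_nth A k * t ^ k) sums euler_prim x t"
    by (rule has_fps_expansion_imp_sums_complex[OF A hol]) (use t in auto)
  ultimately have "(\<lambda>k. fps_nth A (k + 1) * t ^ (k + 1)) sums (euler_prim x t - euler_prim x 0)"
    using sums_Suc_iff[of "\<lambda>k. fps_nth A k * t ^ k" "euler_prim x t - euler_prim x 0"] by simp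
  thus ?thesis
    by (simp only: coeff) (simp add: mult_ac)
qed

text \<open>
  The previous lemma applies to all points of the radius except possibly its end point \<open>b\<close>; if the
  series converges at \<open>b\<close>, Abel's theorem supplies the limit.
\<close>
lemma euler_poly_integrated_abel:
  assumes x: "x \<notin> \<int>\<^sub>\<le>\<^sub>0" and b: "norm b \<le> pi"
    and sm: "(\<lambda>k. b ^ (k + 1) * euler_poly k x / fact (k + 1)) sums s"
  shows "((\<lambda>r. euler_prim x (of_real r * b)) \<longlongrightarrow> s + euler_prim x 0) (at_left 1)"
proof -
  let ?e = "\<lambda>k. b ^ (k + 1) * euler_poly k x / fact (k + 1)"
  have "((\<lambda>r. of_real r * (\<Sum>k. ?e k * of_real r ^ k) + euler_prim x 0) \<longlongrightarrow> of_real 1 * s + euler_prim x 0) (at_left 1)"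
    by (intro tendsto_intros abel_limit sm)
  moreover have "\<forall>\<^sub>F r in at_left 1. of_real r * (\<Sum>k. ?e k * of_real r ^ k) + euler_prim x 0 = euler_prim x (of_real r * b)"
  proof (rule eventually_at_leftI[of 0])
    fix r :: real assume r: "r \<in> {0<..<1}"
    have "r * norm b \<le> r * pi"
      using b r by (intro mult_left_mono) auto
    also have "\<dots> < 1 * pi"
      using r by (intro mult_strict_right_mono) auto
    finally have "norm (of_real r * b) < pi"
      using r by (simp add: norm_mult)
    from euler_poly_integrated_sums[OF x this]
    have "(\<lambda>k. of_real r * (?e k * of_real r ^ k)) sums (euler_prim x (of_real r * b) - euler_prim x 0)"
      by (simp add: power_mult_distrib mult_ac)
    from sums_mult_D[OF this] r
    show "of_real r * (\<Sum>k. ?e k * of_real r ^ k) + euler_prim x 0 = euler_prim x (of_real r * b)"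
      by (simp add: sums_iff)
  qed auto
  ultimately show ?thesis by (simp add: tendsto_cong)
qed

section \<open>Where the integrated series can converge\<close>

text \<open>
  At \<open>b = \<plusminus>\<i> * \<pi>\<close> the generating function has a simple pole, so its primitive grows logarithmically along
  the radius to \<open>b\<close>. If the series converged there, Abel's theorem would force a finite limit.
\<close>
lemma not_summable_at_poles:
  assumes x: "x \<notin> \<int>\<^sub>\<le>\<^sub>0" and b: "b = \<i> * pi \<or> b = - \<i> * pi"
  shows "\<not> summable (\<lambda>k. b ^ (k + 1) * euler_poly k x / fact (k + 1))"
proof
  assume "summable (\<lambda>k. b ^ (k + 1) * euler_poly k x / fact (k + 1))"
  then obtain s where s: "(\<lambda>k. b ^ (k + 1) * euler_poly k x / fact (k + 1)) sums s"
    unfolding summable_def by blast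
  have norm_b: "norm b = pi" and b0: "b \<noteq> 0" and eb: "exp b = -1"
    using b by (auto simp: norm_mult exp_minus)
  (* Normalised by w, the derivative q of f along the radius is asymptotic to 1 / (1 - r). *)
  define w where "w = 2 * exp (x * b)"
  have w0: "w \<noteq> 0" by (simp add: w_def)
  define f where "f r = Re (euler_prim x (of_real r * b) / w)" for r :: real
  define q where "q r = Re (b * (2 * exp (x * (of_real r * b)) / (exp (of_real r * b) + 1)) / w)" for r :: real
  have f_lim: "(f \<longlongrightarrow> Re ((s + euler_prim x 0) / w)) (at_left 1)"
    unfolding f_def using w0 norm_b
    by (intro tendsto_intros euler_poly_integrated_abel x s) auto
  have g_lim: "filterlim (\<lambda>r::real. - ln (1 - r)) at_top (at_left 1)"
    by real_asymp
  have f_deriv: "(f has_real_derivative q r) (at r)" if "r \<in> {0<..<1}" for r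
  proof -
    have "\<bar>Im (of_real r * b)\<bar> < pi"
      using b that by (auto simp: abs_mult)
    from euler_prim_deriv[OF x this]
    have "((\<lambda>z. euler_prim x (z * b)) has_field_derivative
            2 * exp (x * (of_real r * b)) / (exp (of_real r * b) + 1) * b) (at (of_real r))"
      by (rule DERIV_chain2) (auto intro!: derivative_eq_intros)
    from DERIV_cdivide[OF this, of w]
    have "((\<lambda>r. euler_prim x (of_real r * b) / w) has_vector_derivative
            b * (2 * exp (x * (of_real r * b)) / (exp (of_real r * b) + 1)) / w) (at r)"
      by (intro has_vector_derivative_real_field) (simp add: mult_ac)
    from bounded_linear.has_vector_derivative[OF bounded_linear_Re this]
    show ?thesis
      unfolding f_def q_def has_real_derivative_iff_has_vector_derivative .
  qed
  have "((\<lambda>r. f r / (- ln (1 - r))) \<longlongrightarrow> 1) (at_left 1)"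
  proof (rule lhopital_left_at_top[OF g_lim])
    have near: "\<forall>\<^sub>F r in at_left (1::real). r \<in> {0<..<1}"
      by (rule eventually_at_leftI[of 0]) auto
    show "\<forall>\<^sub>F r in at_left (1::real). 1 / (1 - r) \<noteq> 0"
      using near by eventually_elim auto
    show "\<forall>\<^sub>F r in at_left 1. (f has_real_derivative q r) (at r)"
      using near by eventually_elim (rule f_deriv)
    show "\<forall>\<^sub>F r in at_left 1. ((\<lambda>r. - ln (1 - r)) has_real_derivative 1 / (1 - r)) (at r)"
      using near by eventually_elim (auto intro!: derivative_eq_intros)
    (* Since exp b = -1, this quotient controls the simple zero of exp z + 1 at b. *)
    have "((\<lambda>z. (exp z - exp b) / (z - b)) \<longlongrightarrow> exp b) (at b)"
      using DERIV_exp[of b] by (simp add: has_field_derivative_iff)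
    moreover have "filterlim (\<lambda>r. of_real r * b) (at b) (at_left 1)"
    proof (rule filterlim_atI)
      have "((\<lambda>r. of_real r * b) \<longlongrightarrow> of_real 1 * b) (at_left 1)"
        by (intro tendsto_intros)
      thus "((\<lambda>r. of_real r * b) \<longlongrightarrow> b) (at_left 1)" by simp
      show "\<forall>\<^sub>F r in at_left 1. of_real r * b \<noteq> b"
        using near by eventually_elim (use b0 in auto)
    qed
    ultimately have slope: "((\<lambda>r. (exp (of_real r * b) - exp b) / (of_real r * b - b)) \<longlongrightarrow> exp b) (at_left 1)"
      by (rule filterlim_compose)
    have "((\<lambda>r. Re (- (2 * exp (x * (of_real r * b))) / w /
             ((exp (of_real r * b) - exp b) / (of_real r * b - b)))) \<longlongrightarrow>
           Re (- (2 * exp (x * (of_real 1 * b))) / w / exp b)) (at_left 1)"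
      by (intro tendsto_intros slope w0) auto
    also have "Re (- (2 * exp (x * (of_real 1 * b))) / w / exp b) = 1"
      using w0 eb by (simp add: w_def)
    finally show "((\<lambda>r. q r / (1 / (1 - r))) \<longlongrightarrow> 1) (at_left 1)"
    proof (rule Lim_transform_eventually)
      show "\<forall>\<^sub>F r in at_left 1. Re (- (2 * exp (x * (of_real r * b))) / w /
             ((exp (of_real r * b) - exp b) / (of_real r * b - b))) = q r / (1 / (1 - r))"
        using near
      proof eventually_elim
        case (elim r)
        let ?E = "2 * exp (x * (of_real r * b))" and ?d = "exp (of_real r * b) + 1"
        have eq: "- ?E / w / ((exp (of_real r * b) - exp b) / (of_real r * b - b)) =
              of_real (1 - r) * (b * (?E / ?d) / w)"
        proof -
          have "exp (of_real r * b) - exp b = ?d"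
            using eb by simp
          moreover have "of_real r * b - b = - (of_real (1 - r) * b)"
            by (simp add: algebra_simps)
          ultimately show ?thesis
            by (simp only:) (simp add: mult_ac)
        qed
        have Re_mult: "Re (of_real c * z) = c * Re z" for c z
          by simp
        show ?case unfolding q_def eq Re_mult by simp
      qed
    qed
  qed
  moreover have "((\<lambda>r. f r / (- ln (1 - r))) \<longlongrightarrow> 0) (at_left 1)"
    by (rule tendsto_divide_0[OF f_lim]) (rule filterlim_at_top_imp_at_infinity[OF g_lim])
  ultimately have "(1::real) = 0"
    by (intro tendsto_unique[of "at_left (1::real)"]) auto
  thus False by simp
qed

text \<open>
  Convergence at a point of modulus greater than \<open>\<pi>\<close> would imply convergence at \<open>\<i> * \<pi>\<close>. On the circle itself, \<open>\<plusminus>\<i> * \<pi>\<close> are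
  the only points with \<open>\<bar>Im a\<bar> = \<pi>\<close>.
\<close>
lemma summable_imp_in_disc:
  assumes x: "x \<notin> \<int>\<^sub>\<le>\<^sub>0" and sm: "summable (\<lambda>k. a ^ k * euler_poly k x / fact (k + 1))"
  shows "norm a \<le> pi \<and> \<bar>Im a\<bar> < pi"
proof -
  let ?c = "\<lambda>k. euler_poly k x / fact (k + 1)"
  have pole: "\<not> summable (\<lambda>k. ?c k * b ^ k)" if "b = \<i> * pi \<or> b = - \<i> * pi" for b
    using not_summable_at_poles[OF x that] summable_mult[of "\<lambda>k. ?c k * b ^ k" b]
    by (auto simp: mult_ac)
  have sm': "summable (\<lambda>k. ?c k * a ^ k)"
    using sm by (simp add: mult_ac)
  have le: "norm a \<le> pi"
  proof (rule ccontr)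
    assume "\<not> norm a \<le> pi"
    hence "norm (\<i> * complex_of_real pi) < norm a" by (simp add: norm_mult)
    from powser_inside[OF sm' this] pole[of "\<i> * pi"] show False by simp
  qed
  moreover have "\<bar>Im a\<bar> \<noteq> pi"
  proof
    assume Im: "\<bar>Im a\<bar> = pi"
    have "(Re a)\<^sup>2 + (Im a)\<^sup>2 \<le> pi\<^sup>2"
      using power_mono[OF le, of 2] by (simp add: cmod_power2)
    moreover have "(Im a)\<^sup>2 = pi\<^sup>2" using Im by (metis power2_abs)
    ultimately have "Re a = 0" by simp
    with Im have "a = \<i> * pi \<or> a = - \<i> * pi"
      by (auto simp: complex_eq_iff abs_if split: if_splits)
    with pole sm' show False by blast
  qed
  ultimately show ?thesis using abs_Im_le_cmod[of a] by auto
qed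

section \<open>The sum of the series\<close>

theorem theorem4p139:
  fixes a x :: complex
  assumes "a \<noteq> 0"
    and "x \<notin> \<int>\<^sub>\<le>\<^sub>0"
    and "summable (\<lambda>k. a ^ k * euler_poly k x / fact (k + 1))"
  shows "(\<Sum>k. a ^ k * euler_poly k x / fact (k + 1)) =
           (2 * exp (a * x) * hyp2F1 1 x (1 + x) (- exp a)
              + x * (Digamma (x / 2) - Digamma ((1 + x) / 2))) / (a * x)"
proof -
  let ?s = "\<Sum>k. a ^ k * euler_poly k x / fact (k + 1)"
  have x0: "x \<noteq> 0" using assms(2) by auto
  have a: "norm a \<le> pi" "\<bar>Im a\<bar> < pi"
    using summable_imp_in_disc[OF assms(2,3)] by auto
  have "(\<lambda>k. a ^ (k + 1) * euler_poly k x / fact (k + 1)) sums (a * ?s)"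
    using sums_mult[OF summable_sums[OF assms(3)], of a] by (simp add: mult_ac)
  from euler_poly_integrated_abel[OF assms(2) a(1) this]
  have "((\<lambda>r. euler_prim x (of_real r * a)) \<longlongrightarrow> a * ?s + euler_prim x 0) (at_left 1)" .
  moreover have "((\<lambda>r. euler_prim x (of_real r * a)) \<longlongrightarrow> euler_prim x a) (at_left 1)"
  proof (rule isCont_tendsto_compose[of a])
    show "isCont (euler_prim x) a"
      using euler_prim_deriv[OF assms(2) a(2)] by (rule DERIV_isCont)
    have "((\<lambda>r. of_real r * a) \<longlongrightarrow> of_real 1 * a) (at_left 1)"
      by (intro tendsto_intros)
    thus "((\<lambda>r. of_real r * a) \<longlongrightarrow> a) (at_left 1)" by simp
  qed
  ultimately have "a * ?s + euler_prim x 0 = euler_prim x a"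
    by (intro tendsto_unique[of "at_left (1::real)"]) auto
  hence "a * ?s + - (Digamma (x / 2) - Digamma ((1 + x) / 2)) =
           2 * exp (a * x) * hyp2F1 1 x (1 + x) (- exp a) / x"
    unfolding euler_prim_0[OF assms(2)] by (simp add: euler_prim_def)
  moreover have "s = (A + x * B) / (a * x)" if "a * s + - B = A / x" for s A B
    using that assms(1) x0 by (simp add: field_simps)
  ultimately show ?thesis
    by blast
qed

end
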